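(* Define integers $\xi_n$ by the power series expansion \[ \frac{(q^{8},q^{26};q^{34})_\infty}{(q^{9},q^{25};q^{34})_\infty}=\sum_{n=0}^{\infty}\xi_n q^n . \] Then $\xi_{17n+6}=0$ for every integer $n\ge 0$.
   Context: $(\lambda;q)_\infty=\prod_{n\ge0}(1-\lambda q^n)$ and $(\lambda_1,\lambda_2;q)_\infty=(\lambda_1;q)_\infty(\lambda_2;q)_\infty$, understood as formal power series in $q$ (or for $|q|<1$). *)

theory Defs
  imports "HOL-Analysis.Analysis"
begin

(* For formal power series, the infinite product is the limit of the partial products
   in the X-adic metric, which is the library's metric on the type fps. *)
definition qpoch_inf :: "'a::{t2_space,comm_ring_1} \<Rightarrow> 'a \<Rightarrow> 'a" where
  "qpoch_inf a q = (\<Prod>n. 1 - a * q ^ n)"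

definition qpoch_inf2 :: "'a::{t2_space,comm_ring_1} \<Rightarrow> 'a \<Rightarrow> 'a \<Rightarrow> 'a" where
  "qpoch_inf2 a b q = qpoch_inf a q * qpoch_inf b q"

end

theory Submission
  imports Defs "HOL-Computational_Algebra.Formal_Laurent_Series"
begin

text \<open>
  With $z = q^{17}$, $b = q^9$, $c = q^8$, so that $bc = z$, the quotient is
  $(bz, c; z^2)_\infty / (b, cz; z^2)_\infty$, one side of a special case of Ramanujan's
  ${}_1\psi_1$ summation. As a function of $b$ it has a partial fraction expansion: up to a
  factor that is a power series in $q^{17}$ it equals the Lambert series
  \[ \sum_{n\ge0} \Bigl(\frac{q^{17n}}{1-q^{34n+9}} - \frac{q^{17n+8}}{1-q^{34n+25}}\Bigr). \]
  The exponents congruent to 6 modulo 17 are $578nj+425n+153j+108$ in the first part and the same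
  expression with $n$ and $j$ exchanged in the second, so these terms cancel (this is the argument
  of Andrews and Bressoud). A finite version of the partial fraction expansion,
  valid in every field, avoids analysis and is compared with the infinite products one
  coefficient at a time.
\<close>

unbundle no vec_syntax

section \<open>Finite q-products and their partial fraction expansion over a field\<close>

definition qpoch :: "'a::comm_ring_1 \<Rightarrow> 'a \<Rightarrow> nat \<Rightarrow> 'a" where
  "qpoch a q n = (\<Prod>i<n. 1 - a * q ^ i)"

lemma qpoch_0 [simp]: "qpoch a q 0 = 1"
  by (simp add: qpoch_def)

lemma qpoch_Suc: "qpoch a q (Suc n) = qpoch a q n * (1 - a * q ^ n)"
  by (simp add: qpoch_def)

lemma qpoch_add: "qpoch a q (m + n) = qpoch a q m * qpoch (a * q ^ m) q n"
  by (induction n) (simp_all add: qpoch_Suc power_add mult_ac)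

text \<open>Reversing the order of the factors turns a shift of the argument by \<open>q ^ n\<close>
  into negative powers of \<open>q\<close>. This handles the residue at the new pole below and the
  lower half of the symmetric expansion.\<close>

lemma qpoch_reflect:
  fixes x q :: "'a::field"
  assumes "q \<noteq> 0"
  shows "qpoch (x / q ^ n) q n = (\<Prod>i<n. 1 - x / q ^ Suc i)"
proof -
  have "qpoch (x / q ^ n) q n = (\<Prod>i<n. 1 - x / q ^ n * q ^ (n - Suc i))"
    unfolding qpoch_def by (rule prod.nat_diff_reindex [symmetric])
  also have "\<dots> = (\<Prod>i<n. 1 - x / q ^ Suc i)"
  proof (rule prod.cong)
    fix i assume "i \<in> {..<n}"
    then have "q ^ n = q ^ (n - Suc i) * q ^ Suc i"
      by (metis lessThan_iff Suc_leI le_add_diff_inverse2 power_add)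
    then show "1 - x / q ^ n * q ^ (n - Suc i) = 1 - x / q ^ Suc i"
      using assms by simp
  qed simp
  finally show ?thesis .
qed

text \<open>As a function of \<beta>, the quotient has simple poles at q^(-k) for k \<le> m,
  distinct because no positive power of \<open>q\<close> is 1, and its numerator has smaller degree
  than its denominator. The sum lists the residues. The product of the \<open>z - q ^ Suc i\<close>
  is z^k (q/z; q)_k with the division by \<open>z\<close> cleared.\<close>

lemma q_partial_fractions:
  fixes z q \<beta> :: "'a::field"
  assumes q: "q \<noteq> 0" "\<And>j. j > 0 \<Longrightarrow> q ^ j \<noteq> 1"
    and \<beta>: "\<And>k. k \<le> m \<Longrightarrow> \<beta> * q ^ k \<noteq> 1"
  shows "(\<Sum>k\<le>m. (\<Prod>i<k. z - q ^ Suc i) * qpoch z q (m - k)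
            / (qpoch q q k * qpoch q q (m - k)) / (1 - \<beta> * q ^ k))
       = qpoch (\<beta> * z) q m / qpoch \<beta> q (Suc m)"
  using \<beta>
proof (induction m arbitrary: \<beta>)
  case 0
  then show ?case by (simp add: qpoch_def)
next
  case (Suc m)
  define a where "a m k = (\<Prod>i<k. z - q ^ Suc i) * qpoch z q (m - k)
    / (qpoch q q k * qpoch q q (m - k))" for m k
  (* The residue of the new term at q^-(m+1) is the induction hypothesis evaluated there. *)
  define \<gamma> where "\<gamma> = 1 / q ^ Suc m"
  have \<gamma>: "\<gamma> * q ^ k \<noteq> 1" if "k \<le> m" for k
  proof
    assume *: "\<gamma> * q ^ k = 1"
    have "q ^ Suc m = q ^ (Suc m - k) * q ^ k"
      using that by (metis le_SucI le_add_diff_inverse2 power_add)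
    then have "q ^ (Suc m - k) = 1"
      using * q(1) by (simp add: \<gamma>_def)
    then show False using q(2)[of "Suc m - k"] that by simp
  qed
  have nz: "1 - \<beta> * q ^ Suc m \<noteq> 0"
    using Suc.prems[of "Suc m"] by simp
  \<comment> \<open>The factor \<open>1 - z / q\<close> is \<open>1 - \<beta> * z * q ^ m\<close> at
    \<beta> = \<gamma>. Reflecting numerator and denominator gives the coefficient of the new
    pole.\<close>
  have last: "(1 - z / q) * (qpoch (\<gamma> * z) q m / qpoch \<gamma> q (Suc m)) = a (Suc m) (Suc m)"
  proof -
    have "\<gamma> * z = (z / q) / q ^ m"
      by (simp add: \<gamma>_def)
    then have "(1 - z / q) * qpoch (\<gamma> * z) q m = (1 - z / q) * (\<Prod>i<m. 1 - z / q / q ^ Suc i)"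
      using qpoch_reflect[OF q(1), of "z / q" m] by simp
    also have "\<dots> = (\<Prod>i<Suc m. 1 - z / q ^ Suc i)"
      by (simp add: prod.lessThan_Suc_shift del: prod.lessThan_Suc)
    finally have "(1 - z / q) * (qpoch (\<gamma> * z) q m / qpoch \<gamma> q (Suc m))
        = (\<Prod>i<Suc m. 1 - z / q ^ Suc i) / (\<Prod>i<Suc m. 1 - 1 / q ^ Suc i)"
      using qpoch_reflect[OF q(1), of 1 "Suc m"] by (simp add: \<gamma>_def)
    also have "\<dots> = (\<Prod>i<Suc m. (1 - z / q ^ Suc i) / (1 - 1 / q ^ Suc i))"
      by (rule prod_dividef [symmetric])
    also have "\<dots> = (\<Prod>i<Suc m. (z - q ^ Suc i) / (1 - q ^ Suc i))"
    proof (rule prod.cong)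
      fix i
      have "(1 - z / w) / (1 - 1 / w) = (z - w) / (1 - w)" if "w \<noteq> 0" for w
      proof -
        have "(1 - z / w) / (1 - 1 / w) = ((w - z) / w) / ((w - 1) / w)"
          using that by (simp add: diff_divide_distrib)
        also have "\<dots> = (w - z) / (w - 1)"
          using that by simp
        also have "\<dots> = (z - w) / (1 - w)"
          by (metis minus_diff_eq minus_divide_divide)
        finally show ?thesis .
      qed
      then show "(1 - z / q ^ Suc i) / (1 - 1 / q ^ Suc i) = (z - q ^ Suc i) / (1 - q ^ Suc i)"
        using q(1) by simp
    qed simp
    also have "\<dots> = a (Suc m) (Suc m)"
      by (simp add: a_def prod_dividef qpoch_def)
    finally show ?thesis .
  qed
  \<comment> \<open>The extra factor meets each old pole: the product splits into the poles at
    q^(-k) and q^(-m-1). The first part changes \<open>a m k\<close> into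
    \<open>a (Suc m) k\<close>; the second contributes to the new residue.\<close>
  have step: "a m k / (1 - \<beta> * q ^ k) * ((1 - \<beta> * z * q ^ m) / (1 - \<beta> * q ^ Suc m))
      = a (Suc m) k / (1 - \<beta> * q ^ k)
        + (1 - z / q) * (a m k / (1 - \<gamma> * q ^ k)) / (1 - \<beta> * q ^ Suc m)"
    if k: "k \<le> m" for k
  proof -
    \<comment> \<open>With the powers named, the splitting is a rational identity in \<beta>,
      \<open>z\<close>, \<open>q\<close>, \<open>p\<close> and \<open>r\<close>.\<close>
    define p r where "p = q ^ (m - k)" and "r = q ^ k"
    have pr: "q ^ m = p * r"
      using k by (simp add: p_def r_def flip: power_add)
    have nz': "p \<noteq> 0" "r \<noteq> 0" "1 - q * p \<noteq> 0" "1 - \<beta> * r \<noteq> 0" "1 - \<beta> * (q * (p * r)) \<noteq> 0"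
      using q(1) q(2)[of "Suc (m - k)"] Suc.prems[of k] nz k by (auto simp: p_def r_def pr)
    have "\<gamma> * r = 1 / (q * p)"
      using nz' q(1) by (simp add: \<gamma>_def pr)
    moreover have "1 - 1 / (q * p) = (q * p - 1) / (q * p)"
      using nz' q(1) by (simp add: field_simps)
    moreover have "a (Suc m) k = a m k * ((1 - z * p) / (1 - q * p))"
      using k by (simp add: a_def Suc_diff_le qpoch_Suc p_def mult.assoc)
    moreover have "1 / (1 - \<beta> * r) * ((1 - \<beta> * z * (p * r)) / (1 - \<beta> * (q * (p * r))))
      = (1 - z * p) / (1 - q * p) / (1 - \<beta> * r)
        + (1 - z / q) * (1 / ((q * p - 1) / (q * p))) / (1 - \<beta> * (q * (p * r)))"
    proof -
      have "q * p - 1 \<noteq> 0" using nz' by auto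
      have "(1 - z / q) * (1 / ((q * p - 1) / (q * p))) = (z - q) * p / (1 - q * p)"
        using nz' \<open>q * p - 1 \<noteq> 0\<close> q(1) by (simp add: divide_simps) (simp add: algebra_simps)
      moreover have "(1 - \<beta> * z * (p * r)) * (1 - q * p)
        = (1 - z * p) * (1 - \<beta> * (q * (p * r))) + (z - q) * p * (1 - \<beta> * r)"
        by (simp add: algebra_simps)
      then have "(1 - \<beta> * z * (p * r)) / ((1 - \<beta> * r) * (1 - \<beta> * (q * (p * r))))
        = ((1 - z * p) * (1 - \<beta> * (q * (p * r))) + (z - q) * p * (1 - \<beta> * r))
            / ((1 - q * p) * ((1 - \<beta> * r) * (1 - \<beta> * (q * (p * r)))))"
        using nz' by (simp add: divide_simps)
      then have "(1 - \<beta> * z * (p * r)) / ((1 - \<beta> * r) * (1 - \<beta> * (q * (p * r))))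
        = (1 - z * p) / (1 - q * p) / (1 - \<beta> * r) + (z - q) * p / (1 - q * p) / (1 - \<beta> * (q * (p * r)))"
        using nz' by (simp add: add_divide_distrib)
      ultimately show ?thesis by simp
    qed
    then have "a m k * (1 / (1 - \<beta> * r) * ((1 - \<beta> * z * (p * r)) / (1 - \<beta> * (q * (p * r)))))
      = a m k * ((1 - z * p) / (1 - q * p) / (1 - \<beta> * r)
        + (1 - z / q) * (1 / ((q * p - 1) / (q * p))) / (1 - \<beta> * (q * (p * r))))"
      by (rule arg_cong)
    ultimately show ?thesis
      by (simp add: pr ring_distribs flip: r_def)
  qed
  have "qpoch (\<beta> * z) q (Suc m) / qpoch \<beta> q (Suc (Suc m))
      = qpoch (\<beta> * z) q m / qpoch \<beta> q (Suc m) * ((1 - \<beta> * z * q ^ m) / (1 - \<beta> * q ^ Suc m))"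
    by (simp add: qpoch_Suc)
  also have "\<dots> = (\<Sum>k\<le>m. a m k / (1 - \<beta> * q ^ k)) * ((1 - \<beta> * z * q ^ m) / (1 - \<beta> * q ^ Suc m))"
    using Suc.IH[of \<beta>] Suc.prems by (simp add: a_def)
  also have "\<dots> = (\<Sum>k\<le>m. a (Suc m) k / (1 - \<beta> * q ^ k)
        + (1 - z / q) * (a m k / (1 - \<gamma> * q ^ k)) / (1 - \<beta> * q ^ Suc m))"
    unfolding sum_distrib_right by (rule sum.cong) (use step in auto)
  also have "\<dots> = (\<Sum>k\<le>m. a (Suc m) k / (1 - \<beta> * q ^ k))
        + (1 - z / q) * (\<Sum>k\<le>m. a m k / (1 - \<gamma> * q ^ k)) / (1 - \<beta> * q ^ Suc m)"
    by (simp add: sum.distrib sum_distrib_left sum_divide_distrib)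
  also have "(\<Sum>k\<le>m. a m k / (1 - \<gamma> * q ^ k)) = qpoch (\<gamma> * z) q m / qpoch \<gamma> q (Suc m)"
    unfolding a_def using Suc.IH[of \<gamma>] \<gamma> by blast
  also note last
  finally show ?case
    by (simp add: a_def)
qed

text \<open>This is the previous expansion with base z^2, 2N poles and the argument shifted by N
  steps, so that poles lie on both sides of the centre. Since \<open>b * c = z\<close>, the poles on
  the low side become those in \<open>c * z\<close>. The weights are symmetric about the centre, so
  the two halves combine term by term.\<close>

lemma symmetric_partial_fractions:
  fixes b c z :: "'a::field"
  assumes bc: "b * c = z" and z: "z \<noteq> 0" "\<And>j. j > 0 \<Longrightarrow> z ^ j \<noteq> 1"
    and b: "\<And>n. b * (z\<^sup>2) ^ n \<noteq> 1" and c: "\<And>n. c * z * (z\<^sup>2) ^ n \<noteq> 1"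
    and N: "N > 0"
  defines "v \<equiv> \<lambda>m. qpoch z (z\<^sup>2) m / qpoch (z\<^sup>2) (z\<^sup>2) m"
  shows "qpoch (b * z) (z\<^sup>2) (N - 1) * qpoch c (z\<^sup>2) N / (qpoch b (z\<^sup>2) N * qpoch (c * z) (z\<^sup>2) N)
       = (\<Sum>n<N. v (N + n) * v (N - 1 - n) *
            (z ^ n / (1 - b * (z\<^sup>2) ^ n) - c * z ^ n / (1 - c * z * (z\<^sup>2) ^ n)))"
proof -
  define q where "q = z\<^sup>2"
  have q: "q \<noteq> 0" "\<And>j. j > 0 \<Longrightarrow> q ^ j \<noteq> 1"
    using z by (auto simp: q_def simp flip: power_mult)
  have bc0: "b \<noteq> 0" "c \<noteq> 0"
    using bc z(1) by auto
  \<comment> \<open>Dividing by \<open>q ^ N\<close> moves index \<open>N\<close> to the centre: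
    index \<open>N + n\<close> belongs to \<open>b * q ^ n\<close>, and index
    \<open>N - 1 - n\<close> to \<open>1 / (c * z * q ^ n)\<close>.\<close>
  define \<beta> where "\<beta> = b / q ^ N"
  have \<beta>_hi: "\<beta> * q ^ (N + n) = b * q ^ n" for n
    using q(1) by (simp add: \<beta>_def power_add)
  have bq: "b / q ^ Suc n = 1 / (c * z * q ^ n)" for n
    using bc0 q(1) z(1) by (simp add: q_def field_simps power2_eq_square flip: bc)
  have \<beta>_lo: "\<beta> * q ^ (N - 1 - n) = 1 / (c * z * q ^ n)" if "n < N" for n
  proof -
    have "q ^ N = q ^ (N - 1 - n) * q ^ Suc n"
      using that by (simp flip: power_add power_Suc)
    then show ?thesis
      using q(1) by (simp add: \<beta>_def flip: bq)
  qed
  have \<beta>: "\<beta> * q ^ k \<noteq> 1" for k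
  proof (cases "k < N")
    case True
    then show ?thesis using \<beta>_lo[of "N - 1 - k"] c[of "N - 1 - k"] by (simp add: q_def)
  next
    case False
    then show ?thesis using \<beta>_hi[of "k - N"] b[of "k - N"] by (simp add: q_def)
  qed
  define g where "g k = z ^ k * v k * v (2 * N - 1 - k) / (1 - \<beta> * q ^ k)" for k
  \<comment> \<open>Base z^2 is what makes this work: z - z^(2i+2) = z (1 - z q^i), so both factors
    of the coefficient are values of the same \<open>v\<close>.\<close>
  have pz: "(\<Prod>i<k. z - q ^ Suc i) = z ^ k * qpoch z q k" for k
    by (induction k)
      (simp_all add: qpoch_Suc q_def algebra_simps power2_eq_square power_mult_distrib)
  have "(\<Sum>k<2*N. g k) = (\<Sum>k\<le>2*N-1. g k)"
    using N by (intro sum.cong) auto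
  also have "\<dots> = qpoch (\<beta> * z) q (2 * N - 1) / qpoch \<beta> q (Suc (2 * N - 1))"
    using q_partial_fractions[OF q, where \<beta> = \<beta> and z = z and m = "2 * N - 1"] \<beta> unfolding pz
    by (simp add: g_def v_def flip: q_def)
  also have "\<dots> = qpoch (\<beta> * z) q (N + (N - 1)) / qpoch \<beta> q (N + N)"
    using N by (simp add: mult_2)
  also have "\<dots> = qpoch (\<beta> * z) q N / qpoch \<beta> q N * (qpoch (b * z) q (N - 1) / qpoch b q N)"
    using q(1) by (simp add: qpoch_add \<beta>_def)
  also have "qpoch (\<beta> * z) q N / qpoch \<beta> q N = (\<Prod>i<N. (1 - b * z / q ^ Suc i) / (1 - b / q ^ Suc i))"
    using qpoch_reflect[OF q(1), of "b * z" N] qpoch_reflect[OF q(1), of b N]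
    by (simp add: \<beta>_def prod_dividef)
  \<comment> \<open>Rewriting the negative powers by \<open>b * c = z\<close> leaves one
    \<open>z\<close> per factor; the resulting \<open>z ^ N\<close> cancels at the end.\<close>
  also have "\<dots> = (\<Prod>i<N. z * ((1 - c * q ^ i) / (1 - c * z * q ^ i)))"
  proof (rule prod.cong)
    fix i
    have "1 - c * z * q ^ i \<noteq> 0"
      using c[of i] by (simp add: q_def)
    moreover have "c * z * q ^ i - 1 \<noteq> 0"
      using calculation by auto
    moreover have "b * z / q ^ Suc i = 1 / (c * q ^ i)"
    proof -
      have "b * z / q ^ Suc i = b / q ^ Suc i * z"
        by simp
      then show ?thesis
        unfolding bq using z(1) by simp
    qed
    ultimately show "(1 - b * z / q ^ Suc i) / (1 - b / q ^ Suc i) = z * ((1 - c * q ^ i) / (1 - c * z * q ^ i))"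
      unfolding bq using bc0 q(1) z(1)
      by (simp add: divide_simps) (simp add: algebra_simps)
  qed simp
  also have "\<dots> = z ^ N * (qpoch c q N / qpoch (c * z) q N)"
    by (simp add: prod.distrib prod_dividef qpoch_def)
  finally have "z ^ N * (qpoch (b * z) q (N - 1) * qpoch c q N / (qpoch b q N * qpoch (c * z) q N)) = (\<Sum>k<2*N. g k)"
    by (simp add: mult_ac)
  also have "(\<Sum>k<2*N. g k) = (\<Sum>n<N. g n) + (\<Sum>n<N. g (N + n))"
  proof -
    have "(\<Sum>k<N + m. g k) = (\<Sum>n<N. g n) + (\<Sum>n<m. g (N + n))" for m
      by (induction m) (simp_all add: add.assoc)
    then show ?thesis by (simp add: mult_2)
  qed
  \<comment> \<open>The low half is read backwards, so that indices \<open>N - 1 - n\<close> and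
    \<open>N + n\<close>, which share the weight \<open>v (N + n) * v (N - 1 - n)\<close>, are
    paired.\<close>
  also have "(\<Sum>n<N. g n) = (\<Sum>n<N. g (N - Suc n))"
    by (rule sum.nat_diff_reindex [symmetric])
  also have "\<dots> + (\<Sum>n<N. g (N + n)) = (\<Sum>n<N. z ^ N * (v (N + n) * v (N - 1 - n) *
            (z ^ n / (1 - b * q ^ n) - c * z ^ n / (1 - c * z * q ^ n))))"
    unfolding sum.distrib [symmetric]
  proof (rule sum.cong)
    fix n assume "n \<in> {..<N}"
    then have n: "n < N" by simp
    have "1 - c * z * q ^ n \<noteq> 0"
      using c[of n] by (simp add: q_def)
    moreover have "c * z * q ^ n - 1 \<noteq> 0"
      using calculation by auto
    moreover have "z ^ N * (z ^ n * c) = z ^ (N - Suc n) * (c * z * q ^ n)"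
    proof -
      have "z ^ N = z ^ (N - Suc n) * (z * z ^ n)"
        using n by (simp flip: power_add power_Suc)
      then show ?thesis
        by (simp add: q_def power2_eq_square power_mult_distrib)
    qed
    ultimately have low: "z ^ (N - Suc n) / (1 - 1 / (c * z * q ^ n)) = - (z ^ N * (c * z ^ n / (1 - c * z * q ^ n)))"
      using bc0 q(1) z(1)
      by (simp add: divide_simps) (simp add: algebra_simps)
    have factor: "v * - (x * y) + v * (x * w) = x * (v * (w - y))" for v x y w :: 'a
      by (simp add: algebra_simps)
    have "2 * N - 1 - (N - Suc n) = N + n"
      using n by auto
    then have "g (N - Suc n) = v (N + n) * v (N - 1 - n) * (z ^ (N - Suc n) / (1 - 1 / (c * z * q ^ n)))"
      unfolding g_def using \<beta>_lo[OF n] by simp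
    moreover have "2 * N - 1 - (N + n) = N - 1 - n"
      using n by auto
    then have "g (N + n) = v (N + n) * v (N - 1 - n) * (z ^ N * (z ^ n / (1 - b * q ^ n)))"
      unfolding g_def \<beta>_hi by (simp add: power_add)
    ultimately show "g (N - Suc n) + g (N + n) = z ^ N * (v (N + n) * v (N - 1 - n) *
            (z ^ n / (1 - b * q ^ n) - c * z ^ n / (1 - c * z * q ^ n)))"
      unfolding low by (simp only: factor)
  qed simp
  finally have "z ^ N * (qpoch (b * z) q (N - 1) * qpoch c q N / (qpoch b q N * qpoch (c * z) q N))
      = z ^ N * (\<Sum>n<N. v (N + n) * v (N - 1 - n) *
            (z ^ n / (1 - b * q ^ n) - c * z ^ n / (1 - c * z * q ^ n)))"
    unfolding sum_distrib_left .
  then show ?thesis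
    unfolding q_def using z(1) by (subst (asm) mult_left_cancel) auto
qed

section \<open>Truncation of power series and the infinite product\<close>

lemma fps_cutoff_mult_cong:
  assumes "fps_cutoff n f = fps_cutoff n f'" "fps_cutoff n g = fps_cutoff n g'"
  shows "fps_cutoff n (f * g) = fps_cutoff n (f' * g' :: 'a::semiring_0 fps)"
  using assms by (auto simp: fps_cutoff_eq_fps_cutoff_iff fps_mult_nth intro!: sum.cong)

lemma fps_cutoff_inverse_cong:
  fixes f g :: "'a::field fps"
  assumes "fps_cutoff n f = fps_cutoff n g" "f $ 0 \<noteq> 0" "g $ 0 \<noteq> 0"
  shows "fps_cutoff n (inverse f) = fps_cutoff n (inverse g)"
  using assms by (metis fps_cutoff_inverse)

lemma qpoch_nth_0:
  assumes "a $ 0 = 0"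
  shows "qpoch a q n $ 0 = (1 :: 'a::comm_ring_1)"
  using assms by (induction n) (simp_all add: qpoch_Suc)

text \<open>The factor of index n is 1 - X^(a + c n), and a + c n > k as soon as n \<ge> k.\<close>

lemma qpoch_nth_stable:
  fixes a c :: nat
  assumes "a > 0" "c > 0" "k \<le> m" "m \<le> n"
  shows "qpoch (fps_X ^ a) (fps_X ^ c) n $ k = (qpoch (fps_X ^ a) (fps_X ^ c) m $ k :: 'a::comm_ring_1)"
  using assms(4)
proof (induction n rule: dec_induct)
  case (step n)
  have "k < a + c * n"
    using assms step.hyps mult_le_mono1[of 1 c n] by linarith
  then show ?case
    using step.IH
    by (simp add: qpoch_Suc right_diff_distrib fps_X_power_mult_right_nth flip: power_mult power_add)
qed simp

text \<open>The coefficients stabilize, so the diagonal series \<open>P\<close> is the limit of the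
  partial products.\<close>

lemma qpoch_inf_nth:
  fixes a c :: nat
  assumes "a > 0" "c > 0" "k \<le> n"
  shows "qpoch_inf (fps_X ^ a) (fps_X ^ c) $ k = (qpoch (fps_X ^ a) (fps_X ^ c) n $ k :: 'a::idom)"
proof -
  define P :: "'a fps" where "P = Abs_fps (\<lambda>k. qpoch (fps_X ^ a) (fps_X ^ c) k $ k)"
  have P: "qpoch (fps_X ^ a) (fps_X ^ c) n $ k = P $ k" if "k \<le> n" for k n
    using qpoch_nth_stable[OF assms(1,2) order_refl that] by (simp add: P_def)
  have "(\<lambda>n. \<Prod>i\<le>n. 1 - fps_X ^ a * (fps_X ^ c) ^ i) \<longlonglongrightarrow> P"
  proof (rule tendsto_fpsI)
    fix k
    show "\<forall>\<^sub>F n in sequentially. (\<Prod>i\<le>n. 1 - fps_X ^ a * (fps_X ^ c) ^ i) $ k = P $ k"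
      using eventually_ge_at_top[of k]
      by eventually_elim (use P[of k "Suc _"] in \<open>simp add: qpoch_def lessThan_Suc_atMost\<close>)
  qed
  \<comment> \<open>\<open>raw_has_prod\<close> excludes the limit 0; here the constant coefficient
    is 1.\<close>
  moreover have "P \<noteq> 0"
    using P[of 0 0] by auto
  ultimately have "(\<lambda>n. 1 - fps_X ^ a * (fps_X ^ c) ^ n) has_prod P"
    by (simp add: has_prod_def raw_has_prod_def)
  then have "qpoch_inf (fps_X ^ a) (fps_X ^ c) = P"
    unfolding qpoch_inf_def by (rule has_prod_unique [symmetric])
  then show ?thesis
    using P[OF assms(3)] by simp
qed

lemma qpoch_inf_nth_0:
  assumes "a > 0" "c > 0"
  shows "qpoch_inf (fps_X ^ a) (fps_X ^ c) $ 0 = (1 :: 'a::idom)"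
  using qpoch_inf_nth[OF assms, of 0 0] by simp

section \<open>Power series with coefficients in a graded subring\<close>

text \<open>
  Instantiated twice below: constant \<open>\<int>\<close> gives integrality of the coefficients, and
  the full field on the multiples of \<open>d\<close> gives power series in \<open>X ^ d\<close>.
\<close>
locale graded_subring =
  fixes S :: "nat \<Rightarrow> 'a::field set"
  assumes zero: "0 \<in> S n"
    and add: "x \<in> S n \<Longrightarrow> y \<in> S n \<Longrightarrow> x + y \<in> S n"
    and uminus: "x \<in> S n \<Longrightarrow> - x \<in> S n"
    and one: "1 \<in> S 0"
    and mult: "x \<in> S m \<Longrightarrow> y \<in> S n \<Longrightarrow> x * y \<in> S (m + n)"
begin

definition series :: "'a fps set" where
  "series = {f. \<forall>n. f $ n \<in> S n}"

lemma series_nth: "f \<in> series \<Longrightarrow> f $ n \<in> S n"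
  by (simp add: series_def)

lemma sum_closed: "(\<And>i. i \<in> A \<Longrightarrow> f i \<in> S n) \<Longrightarrow> sum f A \<in> S n"
  by (induction A rule: infinite_finite_induct) (auto simp: zero add)

lemma series_one: "1 \<in> series"
  by (auto simp: series_def zero one)

lemma series_X_power: "1 \<in> S k \<Longrightarrow> fps_X ^ k \<in> series"
  by (auto simp: series_def zero)

lemma series_diff:
  assumes "f \<in> series" "g \<in> series"
  shows "f - g \<in> series"
proof -
  have "(f - g) $ n \<in> S n" for n
    using add[OF series_nth[OF assms(1)] uminus[OF series_nth[OF assms(2)]]] by simp
  then show ?thesis
    by (simp add: series_def)
qed

lemma series_mult:
  assumes "f \<in> series" "g \<in> series"
  shows "f * g \<in> series"
proof -
  have "f $ i * g $ (n - i) \<in> S n" if "i \<in> {0..n}" for i n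
    using mult[OF series_nth[OF assms(1), of i] series_nth[OF assms(2), of "n - i"]] that by simp
  then have "(f * g) $ n \<in> S n" for n
    unfolding fps_mult_nth by (rule sum_closed)
  then show ?thesis
    by (simp add: series_def)
qed

lemma series_power: "f \<in> series \<Longrightarrow> f ^ n \<in> series"
  by (induction n) (auto simp: series_one series_mult)

text \<open>With constant coefficient 1, the recursion for the coefficients of the inverse involves
  no division.\<close>

lemma series_inverse:
  assumes f: "f \<in> series" "f $ 0 = 1"
  shows "inverse f \<in> series"
proof -
  have "inverse f $ n \<in> S n" for n
  proof (induction n rule: less_induct)
    case (less n)
    show ?case
    proof (cases "n = 0")
      case False
      have "0 = (f * inverse f) $ n"
        using False f(2) by (simp add: inverse_mult_eq_1')
      also have "\<dots> = inverse f $ n + (\<Sum>i=Suc 0..n. f $ i * inverse f $ (n - i))"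
        by (simp add: fps_mult_nth sum.atLeast_Suc_atMost f(2))
      finally have "inverse f $ n = - (\<Sum>i=Suc 0..n. f $ i * inverse f $ (n - i))"
        by (simp add: eq_neg_iff_add_eq_0)
      moreover have "f $ i * inverse f $ (n - i) \<in> S n" if "i \<in> {Suc 0..n}" for i
        using mult[OF series_nth[OF f(1), of i] less.IH[of "n - i"]] that by simp
      ultimately show ?thesis
        by (simp only: uminus sum_closed)
    qed (simp add: one f(2))
  qed
  then show ?thesis by (simp add: series_def)
qed

lemma series_qpoch: "a \<in> series \<Longrightarrow> q \<in> series \<Longrightarrow> qpoch a q n \<in> series"
  by (induction n) (simp_all add: qpoch_Suc series_one series_mult series_diff series_power)

end

interpretation integral: graded_subring "\<lambda>_. \<int> :: rat set"
  by unfold_locales auto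

interpretation supported: graded_subring "\<lambda>n. if d dvd n then UNIV else {0 :: 'a::field}" for d
  by unfold_locales (auto split: if_splits)

section \<open>Transfer from Laurent series to power series\<close>

lemma fps_to_fls_prod: "fps_to_fls (prod f A) = (\<Prod>x\<in>A. fps_to_fls (f x :: 'a::comm_ring_1 fps))"
  by (induction A rule: infinite_finite_induct) (simp_all add: fls_times_fps_to_fls)

lemma fps_to_fls_sum: "fps_to_fls (sum f A) = (\<Sum>x\<in>A. fps_to_fls (f x :: 'a::comm_ring_1 fps))"
  by (induction A rule: infinite_finite_induct) simp_all

lemma fps_to_fls_qpoch: "fps_to_fls (qpoch a q n) = qpoch (fps_to_fls a) (fps_to_fls q) n"
  by (simp add: qpoch_def fps_to_fls_prod fls_times_fps_to_fls fps_to_fls_power)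

text \<open>Power series embed injectively into the field of Laurent series, where the expansion
  applies. Its nonvanishing hypotheses hold because the series in question have constant coefficient
  0 and so differ from 1; all denominators are units, so inverses are preserved.\<close>

lemma fps_symmetric_partial_fractions:
  fixes b c :: "'a::field fps"
  assumes b: "b \<noteq> 0" "b $ 0 = 0" and c: "c \<noteq> 0" "c $ 0 = 0" and N: "N > 0"
  defines "z \<equiv> b * c"
  defines "v \<equiv> \<lambda>m. qpoch z (z\<^sup>2) m * inverse (qpoch (z\<^sup>2) (z\<^sup>2) m)"
  shows "qpoch (b * z) (z\<^sup>2) (N - 1) * qpoch c (z\<^sup>2) N * inverse (qpoch b (z\<^sup>2) N * qpoch (c * z) (z\<^sup>2) N)
       = (\<Sum>n<N. v (N + n) * v (N - 1 - n) *
            (z ^ n * inverse (1 - b * (z\<^sup>2) ^ n) - c * z ^ n * inverse (1 - c * z * (z\<^sup>2) ^ n)))"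
    (is "?l = ?r")
proof -
  let ?F = "fps_to_fls :: 'a fps \<Rightarrow> 'a fls"
  have z0: "z $ 0 = 0" "(z\<^sup>2) $ 0 = 0" and z: "z \<noteq> 0"
    using b c by (simp_all add: z_def power2_eq_square)
  have ne1: "?F f \<noteq> 1" if "f $ 0 = 0" for f
    using that by auto
  have hom: "?F z ^ j = ?F (z ^ j)" "(?F z)\<^sup>2 = ?F (z\<^sup>2)" "?F (z\<^sup>2) ^ j = ?F ((z\<^sup>2) ^ j)"
      "?F f * ?F g = ?F (f * g)" for j f g
    by (simp_all add: fps_to_fls_power fls_times_fps_to_fls)
  have eq: "qpoch (?F b * ?F z) ((?F z)\<^sup>2) (N - 1) * qpoch (?F c) ((?F z)\<^sup>2) N
        / (qpoch (?F b) ((?F z)\<^sup>2) N * qpoch (?F c * ?F z) ((?F z)\<^sup>2) N)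
      = (\<Sum>n<N. qpoch (?F z) ((?F z)\<^sup>2) (N + n) / qpoch ((?F z)\<^sup>2) ((?F z)\<^sup>2) (N + n)
            * (qpoch (?F z) ((?F z)\<^sup>2) (N - 1 - n) / qpoch ((?F z)\<^sup>2) ((?F z)\<^sup>2) (N - 1 - n)) *
            (?F z ^ n / (1 - ?F b * ((?F z)\<^sup>2) ^ n) - ?F c * ?F z ^ n / (1 - ?F c * ?F z * ((?F z)\<^sup>2) ^ n)))"
  proof (rule symmetric_partial_fractions)
    show "?F z ^ j \<noteq> 1" if "j > 0" for j
      unfolding hom by (rule ne1) (use that z0 in \<open>simp add: fps_power_zeroth\<close>)
    show "?F b * ((?F z)\<^sup>2) ^ n \<noteq> 1" "?F c * ?F z * ((?F z)\<^sup>2) ^ n \<noteq> 1" for n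
      unfolding hom by (rule ne1; simp add: b c)+
  qed (use z N in \<open>simp_all add: z_def fls_times_fps_to_fls\<close>)
  have inv: "?F (inverse (qpoch f g n)) = inverse (qpoch (?F f) (?F g) n)"
    if "f $ 0 = 0" for f g :: "'a fps" and n
    using that by (simp add: fls_inverse_fps_to_fls qpoch_nth_0 fps_to_fls_qpoch[symmetric])
  have inv1: "?F (inverse (1 - f)) = inverse (1 - ?F f)" if "f $ 0 = 0" for f :: "'a fps"
    using that by (simp add: fls_inverse_fps_to_fls[symmetric])
  have cz: "(c * z) $ 0 = 0" "(b * (z\<^sup>2) ^ n) $ 0 = 0" "(c * z * (z\<^sup>2) ^ n) $ 0 = 0" for n
    using b c by simp_all
  have "?F ?l = ?F ?r"
    unfolding v_def fps_inverse_mult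
    using eq[unfolded divide_inverse inverse_mult_distrib]
    by (simp only: fps_to_fls_sum fls_times_fps_to_fls fps_to_fls_minus fps_to_fls_power
        fps_to_fls_qpoch inv[OF b(2)] inv[OF z0(2)] inv[OF cz(1)] inv1[OF cz(2)] inv1[OF cz(3)])
  then show ?thesis by simp
qed

section \<open>Coefficients of the Lambert series\<close>

lemma inverse_one_minus_X_power:
  assumes "k > 0"
  shows "inverse (1 - fps_X ^ k :: 'a::field fps) = Abs_fps (\<lambda>n. of_bool (k dvd n))"
proof (rule fps_inverse_unique)
  show "(1 - fps_X ^ k :: 'a fps) * Abs_fps (\<lambda>n. of_bool (k dvd n)) = 1"
  proof (rule fps_ext)
    fix n
    show "((1 - fps_X ^ k :: 'a fps) * Abs_fps (\<lambda>n. of_bool (k dvd n))) $ n = 1 $ n"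
      using assms by (cases "n < k")
        (auto simp: left_diff_distrib fps_X_power_mult_nth dvd_minus_self dest: dvd_imp_le)
  qed
qed

text \<open>After expansion into geometric series, each part counts the n for which its denominator
  exponent divides what is left of the target exponent. Both counts turn out to be the size of one
  set of pairs.\<close>

lemma lambert_coeff_vanish:
  assumes N: "17 * t + 6 < N"
  shows "(\<Sum>n<N. fps_X ^ (17 * n) * (inverse (1 - fps_X ^ (9 + 34 * n))
            - fps_X ^ 8 * inverse (1 - fps_X ^ (25 + 34 * n)))) $ (17 * t + 6) = (0 :: 'a::field)"
proof -
  define M where "M = 17 * t + 6"
  \<comment> \<open>The cofactor m of 9 + 34n satisfies 9m = 6 modulo 17, hence m = 12 +
    17j.\<close>
  define A where "A = {(n, j). 17 * n + (12 + 17 * j) * (9 + 34 * n) = M}"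
  (* Exchanging the roles of n and j turns an exponent of the first part into one of the second. *)
  have A_sym: "(n, j) \<in> A \<longleftrightarrow> 17 * j + 8 + (4 + 17 * n) * (25 + 34 * j) = M" for n j
    by (simp add: A_def algebra_simps)
  have P: "17 * n \<le> M \<and> 9 + 34 * n dvd M - 17 * n \<longleftrightarrow> n \<in> fst ` A" for n
  proof
    assume *: "17 * n \<le> M \<and> 9 + 34 * n dvd M - 17 * n"
    then obtain m where "M - 17 * n = (9 + 34 * n) * m"
      by (elim conjE dvdE)
    with * have m: "17 * n + m * (9 + 34 * n) = M"
      by (simp add: mult.commute)
    then have "17 * n + 9 * m + 34 * (m * n) = 17 * t + 6"
      by (simp add: M_def algebra_simps)
    \<comment> \<open>Twice the hypothesis, since 2 inverts 9 modulo 17. The variable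
      \<open>w\<close> replaces the product \<open>m * n\<close> to keep the arithmetic
      linear.\<close>
    moreover have "m + 17 * (m + 2 * n + 4 * w) = 12 + 17 * (2 * t)"
      if "17 * n + 9 * m + 34 * w = 17 * t + 6" for w
      using that by presburger
    ultimately have "m + 17 * (m + 2 * n + 4 * (m * n)) = 12 + 17 * (2 * t)"
      by blast
    then have "(m + 17 * (m + 2 * n + 4 * (m * n))) mod 17 = (12 + 17 * (2 * t)) mod 17"
      by (rule arg_cong)
    then have "m mod 17 = 12"
      unfolding mod_mult_self2 by simp
    then have "m = 12 + 17 * (m div 17)"
      by (metis add.commute mult_div_mod_eq)
    then show "n \<in> fst ` A"
      using m by (intro image_eqI[of _ _ "(n, m div 17)"]) (auto simp: A_def)
  next
    assume "n \<in> fst ` A"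
    then obtain j where M: "M = 17 * n + (12 + 17 * j) * (9 + 34 * n)"
      by (auto simp: A_def)
    show "17 * n \<le> M \<and> 9 + 34 * n dvd M - 17 * n"
      unfolding M by (simp only: le_add1 diff_add_inverse dvd_triv_right simp_thms)
  qed
  have Q: "17 * j + 8 \<le> M \<and> 25 + 34 * j dvd M - (17 * j + 8) \<longleftrightarrow> j \<in> snd ` A" for j
  proof
    assume *: "17 * j + 8 \<le> M \<and> 25 + 34 * j dvd M - (17 * j + 8)"
    then obtain m where "M - (17 * j + 8) = (25 + 34 * j) * m"
      by (elim conjE dvdE)
    with * have m: "17 * j + 8 + m * (25 + 34 * j) = M"
      by (simp add: mult.commute)
    then have "17 * j + 8 + 25 * m + 34 * (m * j) = 17 * t + 6"
      by (simp add: M_def algebra_simps)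
    \<comment> \<open>Doubling again: 2 * 25 = -1 modulo 17, so 16 - m = 12 and m = 4 modulo
      17.\<close>
    moreover have "m + 17 * (2 * t) = 4 + 17 * (3 * m + 2 * j + 4 * w)"
      if "17 * j + 8 + 25 * m + 34 * w = 17 * t + 6" for w
      using that by presburger
    ultimately have "m + 17 * (2 * t) = 4 + 17 * (3 * m + 2 * j + 4 * (m * j))"
      by blast
    then have "(m + 17 * (2 * t)) mod 17 = (4 + 17 * (3 * m + 2 * j + 4 * (m * j))) mod 17"
      by (rule arg_cong)
    then have "m mod 17 = 4"
      unfolding mod_mult_self2 by simp
    then have "m = 4 + 17 * (m div 17)"
      by (metis add.commute mult_div_mod_eq)
    then show "j \<in> snd ` A"
      using m by (intro image_eqI[of _ _ "(m div 17, j)"]) (auto simp: A_sym)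
  next
    assume "j \<in> snd ` A"
    then obtain n where "(n, j) \<in> A"
      by auto
    then have M: "M = 17 * j + 8 + (4 + 17 * n) * (25 + 34 * j)"
      by (simp only: A_sym)
    show "17 * j + 8 \<le> M \<and> 25 + 34 * j dvd M - (17 * j + 8)"
      unfolding M by (simp only: le_add1 diff_add_inverse dvd_triv_right simp_thms)
  qed
  \<comment> \<open>Either coordinate fixes the divisor, hence the cofactor and the other
    coordinate. Both projections of \<open>A\<close> therefore have equally many elements.\<close>
  have "inj_on fst A"
  proof (rule inj_onI, clarsimp)
    fix n j j'
    assume "(n, j) \<in> A" "(n, j') \<in> A"
    then have "17 * n + (12 + 17 * j) * (9 + 34 * n) = 17 * n + (12 + 17 * j') * (9 + 34 * n)"
      by (simp only: A_def mem_Collect_eq prod.case)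
    then have "(12 + 17 * j) * (9 + 34 * n) = (12 + 17 * j') * (9 + 34 * n)"
      by (simp only: add_left_cancel)
    then show "j = j'"
      by simp
  qed
  moreover have "inj_on snd A"
  proof (rule inj_onI, clarsimp)
    fix n n' j
    assume "(n, j) \<in> A" "(n', j) \<in> A"
    then have "17 * j + 8 + (4 + 17 * n) * (25 + 34 * j) = 17 * j + 8 + (4 + 17 * n') * (25 + 34 * j)"
      by (simp only: A_sym)
    then have "(4 + 17 * n) * (25 + 34 * j) = (4 + 17 * n') * (25 + 34 * j)"
      by (simp only: add_left_cancel)
    then show "n = n'"
      by simp
  qed
  ultimately have card: "card (fst ` A) = card (snd ` A)"
    by (simp add: card_image)
  \<comment> \<open>The summation range n < N loses no solution, because n \<le> M < N.\<close>
  have bound: "fst ` A \<subseteq> {..<N}" "snd ` A \<subseteq> {..<N}"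
  proof -
    have "n < N" if "17 * n \<le> M \<and> 9 + 34 * n dvd M - 17 * n" for n
      using that N by (simp add: M_def)
    then show "fst ` A \<subseteq> {..<N}"
      using P by blast
    have "j < N" if "17 * j + 8 \<le> M \<and> 25 + 34 * j dvd M - (17 * j + 8)" for j
      using that N by (simp add: M_def)
    then show "snd ` A \<subseteq> {..<N}"
      using Q by blast
  qed
  have "(\<Sum>n<N. fps_X ^ (17 * n) * (inverse (1 - fps_X ^ (9 + 34 * n))
            - fps_X ^ 8 * inverse (1 - fps_X ^ (25 + 34 * n)))) $ M
      = (\<Sum>n<N. (fps_X ^ (17 * n) * inverse (1 - fps_X ^ (9 + 34 * n))) $ M
            - (fps_X ^ (17 * n + 8) * inverse (1 - fps_X ^ (25 + 34 * n))) $ M :: 'a)"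
    by (simp add: fps_sum_nth right_diff_distrib power_add mult.assoc)
  also have "\<dots> = (\<Sum>n<N. of_bool (n \<in> fst ` A) - of_bool (n \<in> snd ` A))"
    unfolding P [symmetric] Q [symmetric]
    by (rule sum.cong) (auto simp: inverse_one_minus_X_power fps_X_power_mult_nth)
  also have "\<dots> = of_nat (card (fst ` A)) - of_nat (card (snd ` A))"
    using bound by (simp add: sum_subtractf sum_of_bool_eq Int_absorb1 Collect_conj_eq)
  finally show ?thesis
    by (simp add: card M_def)
qed

section \<open>From the finite expansion to the infinite products\<close>

text \<open>The weight \<open>v\<close> of the symmetric expansion for z = X^d.\<close>

definition base_quotient :: "nat \<Rightarrow> nat \<Rightarrow> 'a::field fps" where
  "base_quotient d m = qpoch (fps_X ^ d) (fps_X ^ (2 * d)) m * inverse (qpoch (fps_X ^ (2 * d)) (fps_X ^ (2 * d)) m)"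

lemma base_quotient_stable:
  assumes "d > 0" "k \<le> m" "m \<le> n"
  shows "fps_cutoff (Suc k) (base_quotient d n) = fps_cutoff (Suc k) (base_quotient d m :: 'a::field fps)"
  unfolding base_quotient_def
proof (intro fps_cutoff_mult_cong fps_cutoff_inverse_cong)
  show "fps_cutoff (Suc k) (qpoch (fps_X ^ d) (fps_X ^ (2 * d)) n)
      = fps_cutoff (Suc k) (qpoch (fps_X ^ d) (fps_X ^ (2 * d)) m :: 'a fps)"
    unfolding fps_cutoff_eq_fps_cutoff_iff using assms by (auto intro: qpoch_nth_stable)
  show "fps_cutoff (Suc k) (qpoch (fps_X ^ (2 * d)) (fps_X ^ (2 * d)) n)
      = fps_cutoff (Suc k) (qpoch (fps_X ^ (2 * d)) (fps_X ^ (2 * d)) m :: 'a fps)"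
    unfolding fps_cutoff_eq_fps_cutoff_iff using assms by (auto intro: qpoch_nth_stable)
qed (use assms in \<open>simp_all add: qpoch_nth_0\<close>)

text \<open>Multiplication by such a product moves exponents only within their residue class modulo
  \<open>d\<close>.\<close>

lemma base_quotient_support:
  assumes "d > 0" "\<not> d dvd i"
  shows "(base_quotient d m * base_quotient d n) $ i = (0 :: 'a::field)"
proof -
  have X: "fps_X ^ d \<in> supported.series d" "fps_X ^ (2 * d) \<in> supported.series d"
    by (auto intro!: supported.series_X_power)
  have "base_quotient d n \<in> supported.series d" for n
    unfolding base_quotient_def
    by (intro supported.series_mult supported.series_inverse supported.series_qpoch X)
      (use assms(1) in \<open>simp add: qpoch_nth_0\<close>)
  then have "base_quotient d m * base_quotient d n \<in> supported.series d"
    by (intro supported.series_mult)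
  then show ?thesis
    using supported.series_nth[of _ d i] assms(2) by fastforce
qed

text \<open>Up to exponent \<open>M\<close>, the infinite products agree with those of the finite
  expansion, and the weights depending on n may be replaced by one common factor.\<close>

lemma quotient_coeff_eq:
  fixes F G :: "rat fps"
  defines "F \<equiv> qpoch_inf2 (fps_X ^ 8) (fps_X ^ 26) (fps_X ^ 34)"
    and "G \<equiv> qpoch_inf2 (fps_X ^ 9) (fps_X ^ 25) (fps_X ^ 34)"
  assumes M: "M < N"
  shows "(F * inverse G) $ M
    = (base_quotient 17 N * base_quotient 17 N
        * (\<Sum>n<N. fps_X ^ (17 * n) * (inverse (1 - fps_X ^ (9 + 34 * n))
            - fps_X ^ 8 * inverse (1 - fps_X ^ (25 + 34 * n))))) $ M"
proof -
  let ?h = "\<lambda>n. inverse (1 - fps_X ^ (9 + 34 * n)) - fps_X ^ 8 * inverse (1 - fps_X ^ (25 + 34 * n)) :: rat fps"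
  let ?v = "base_quotient 17 :: nat \<Rightarrow> rat fps"
  let ?p = "\<lambda>a. qpoch (fps_X ^ a) (fps_X ^ 34) :: nat \<Rightarrow> rat fps"
  let ?P = "\<lambda>a. qpoch_inf (fps_X ^ a) (fps_X ^ 34) :: rat fps"
  have X: "fps_X ^ 9 * fps_X ^ 8 = (fps_X ^ 17 :: rat fps)" "(fps_X ^ 17)\<^sup>2 = (fps_X ^ 34 :: rat fps)"
      "fps_X ^ 9 * fps_X ^ 17 = (fps_X ^ 26 :: rat fps)" "fps_X ^ 8 * fps_X ^ 17 = (fps_X ^ 25 :: rat fps)"
    by (simp_all flip: power_add power_mult)
  have X': "(fps_X ^ 17) ^ n = (fps_X ^ (17 * n) :: rat fps)"
      "fps_X ^ 9 * (fps_X ^ 34) ^ n = (fps_X ^ (9 + 34 * n) :: rat fps)"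
      "fps_X ^ 25 * (fps_X ^ 34) ^ n = (fps_X ^ (25 + 34 * n) :: rat fps)" for n
    by (simp_all flip: power_add power_mult)
  have fin: "?p 26 (N - 1) * ?p 8 N * inverse (?p 9 N * ?p 25 N)
      = (\<Sum>n<N. ?v (N + n) * ?v (N - 1 - n) * (fps_X ^ (17 * n) * ?h n))"
    using fps_symmetric_partial_fractions[of "fps_X ^ 9 :: rat fps" "fps_X ^ 8" N] M
    unfolding X unfolding X' by (simp add: base_quotient_def right_diff_distrib mult_ac)
  have P: "fps_cutoff (Suc M) (?P a) = fps_cutoff (Suc M) (?p a n)" if "a > 0" "M \<le> n" for a n
    unfolding fps_cutoff_eq_fps_cutoff_iff using that by (auto intro: qpoch_inf_nth)
  \<comment> \<open>The shortest product has \<open>N - 1\<close> factors, which suffices because M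
    \<le> N - 1.\<close>
  have "fps_cutoff (Suc M) (?P 26 * ?P 8 * inverse (?P 9 * ?P 25))
      = fps_cutoff (Suc M) (?p 26 (N - 1) * ?p 8 N * inverse (?p 9 N * ?p 25 N))"
    using M by (intro fps_cutoff_mult_cong fps_cutoff_inverse_cong P)
      (simp_all add: qpoch_nth_0 qpoch_inf_nth_0)
  then have "(F * inverse G) $ M = (?p 26 (N - 1) * ?p 8 N * inverse (?p 9 N * ?p 25 N)) $ M"
    by (simp add: fps_cutoff_eq_fps_cutoff_iff F_def G_def qpoch_inf2_def mult.commute)
  also have "\<dots> = (\<Sum>n<N. (fps_X ^ (17 * n) * (?v (N + n) * ?v (N - 1 - n) * ?h n)) $ M)"
    unfolding fin by (simp add: fps_sum_nth mult_ac)
  also have "\<dots> = (\<Sum>n<N. (fps_X ^ (17 * n) * (?v N * ?v N * ?h n)) $ M)"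
  proof (rule sum.cong)
    fix n assume "n \<in> {..<N}"
    show "(fps_X ^ (17 * n) * (?v (N + n) * ?v (N - 1 - n) * ?h n)) $ M
        = (fps_X ^ (17 * n) * (?v N * ?v N * ?h n)) $ M"
    \<comment> \<open>The weight \<open>?v (N - 1 - n)\<close> is too short to be stable up to
      \<open>M\<close>, but the factor X^(17n) lowers the required index to M - 17n \<le> N - 1 -
      n.\<close>
    proof (cases "M < 17 * n")
      case False
      have "fps_cutoff (Suc (M - 17 * n)) (?v (N + n) * ?v (N - 1 - n) * ?h n)
          = fps_cutoff (Suc (M - 17 * n)) (?v N * ?v N * ?h n)"
        using M False
        by (intro fps_cutoff_mult_cong refl base_quotient_stable base_quotient_stable[symmetric]) auto
      then show ?thesis
        using False by (simp add: fps_X_power_mult_nth fps_cutoff_eq_fps_cutoff_iff)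
    qed (simp add: fps_X_power_mult_nth)
  qed simp
  also have "\<dots> = (?v N * ?v N * (\<Sum>n<N. fps_X ^ (17 * n) * ?h n)) $ M"
    by (simp add: fps_sum_nth sum_distrib_left mult.left_commute mult.assoc)
  finally show ?thesis .
qed

section \<open>Integrality and vanishing of the coefficients\<close>

theorem theorem3p1:
  shows "\<exists>\<xi> :: nat \<Rightarrow> int.
    (qpoch_inf2 (fps_X ^ 8) (fps_X ^ 26) (fps_X ^ 34) /
     qpoch_inf2 (fps_X ^ 9) (fps_X ^ 25) (fps_X ^ 34) :: rat fps)
      = Abs_fps (\<lambda>n. of_int (\<xi> n))
    \<and> (\<forall>n. \<xi> (17 * n + 6) = 0)"
proof -
  let ?F = "qpoch_inf2 (fps_X ^ 8) (fps_X ^ 26) (fps_X ^ 34) :: rat fps"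
  let ?G = "qpoch_inf2 (fps_X ^ 9) (fps_X ^ 25) (fps_X ^ 34) :: rat fps"
  define \<phi> where "\<phi> = ?F * inverse ?G"
  have X: "fps_X ^ k \<in> integral.series" for k
    by (rule integral.series_X_power) simp
  have inf: "qpoch_inf (fps_X ^ a) (fps_X ^ c) \<in> integral.series" if "a > 0" "c > 0" for a c
    using integral.series_nth[OF integral.series_qpoch[OF X X]] that
    by (simp add: integral.series_def qpoch_inf_nth[OF that order_refl])
  have G0: "?G $ 0 = 1"
    by (simp add: qpoch_inf2_def qpoch_inf_nth_0)
  \<comment> \<open>Division of power series is multiplication by the inverse here, because the
    denominator is a unit.\<close>
  have div: "?F / ?G = \<phi>"
    unfolding \<phi>_def using G0 by (intro fps_divide_unit) simp
  have "\<phi> \<in> integral.series"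
    unfolding \<phi>_def using G0
    by (intro integral.series_mult integral.series_inverse) (simp_all add: qpoch_inf2_def integral.series_mult inf)
  \<comment> \<open>The integers \<xi> are the floors of the coefficients, which are already
    integral.\<close>
  then have int: "of_int \<lfloor>\<phi> $ n\<rfloor> = \<phi> $ n" for n
    using integral.series_nth[of \<phi> n] by (auto elim: Ints_cases)
  have "\<phi> $ (17 * t + 6) = 0" for t
  proof -
    \<comment> \<open>The least bound above 17t + 6; it also exceeds every smaller index 17(t - s) +
      6 needed below.\<close>
    define N where "N = 17 * t + 7"
    let ?W = "base_quotient 17 N * base_quotient 17 N :: rat fps"
    let ?S = "\<Sum>n<N. fps_X ^ (17 * n) * (inverse (1 - fps_X ^ (9 + 34 * n))
            - fps_X ^ 8 * inverse (1 - fps_X ^ (25 + 34 * n))) :: rat fps"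
    have "\<phi> $ (17 * t + 6) = (?W * ?S) $ (17 * t + 6)"
      unfolding \<phi>_def by (rule quotient_coeff_eq) (simp add: N_def)
    also have "\<dots> = (\<Sum>i=0..17 * t + 6. ?W $ i * ?S $ (17 * t + 6 - i))"
      by (rule fps_mult_nth)
    also have "\<dots> = 0"
    proof (rule sum.neutral, rule ballI)
      fix i assume i: "i \<in> {0..17 * t + 6}"
      show "?W $ i * ?S $ (17 * t + 6 - i) = 0"
      \<comment> \<open>\<open>?W\<close> lives on multiples of 17, so only coefficients of
        \<open>?S\<close> at indices congruent to 6 can contribute, and these vanish.\<close>
      proof (cases "17 dvd i")
        case True
        then obtain s where s: "i = 17 * s" ..
        with i have "s \<le> t" by simp
        then have "17 * t + 6 - i = 17 * (t - s) + 6"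
          by (simp add: s)
        moreover have "?S $ (17 * (t - s) + 6) = 0"
          by (rule lambert_coeff_vanish) (simp add: N_def)
        ultimately show ?thesis by simp
      next
        case False
        have "?W $ i = 0"
          by (rule base_quotient_support[OF _ False]) simp
        then show ?thesis by simp
      qed
    qed
    finally show ?thesis .
  qed
  then have "?F / ?G = Abs_fps (\<lambda>n. of_int \<lfloor>\<phi> $ n\<rfloor>) \<and> (\<forall>n. \<lfloor>\<phi> $ (17 * n + 6)\<rfloor> = 0)"
    by (simp add: div int fps_eq_iff)
  then show ?thesis
    by (rule exI[of _ "\<lambda>n. \<lfloor>\<phi> $ n\<rfloor>"])
qed

end
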